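(* Let $\mathbf{K}\subset\mathbb{R}^n$ be a closed basic semialgebraic set, let $\mu$ be a Borel measure with $\operatorname{supp}(\mu)=\mathbf{K}$ all of whose moments are finite, and let $f\in\mathbb{R}[X_1,\dots,X_n]$. Let $d\in\mathbb{N}$ and let $\sigma\in\Sigma$ with $\deg(\sigma)\le d$ and $\int\sigma\,d\mu=1$. Define $\check{x}^{(\sigma)}\in\mathbb{R}^n$ by $\check{x}^{(\sigma)}_i:=\int X_i\cdot\sigma\,d\mu$ for $i=1,\dots,n$. Then $\check{x}^{(\sigma)}\in\mathrm{conv}(\mathbf{K})$. If, in addition, $f$ is convex on $\mathrm{conv}(\mathbf{K})$, then $$f(\check{x}^{(\sigma)})\le\int f\cdot\sigma\,d\mu.$$
   Context: $\Sigma$ is the set of finite sums of squares of polynomials in $\mathbb{R}[X_1,\dots,X_n]$. A closed basic semialgebraic set is a set of the form $\{x\in\mathbb{R}^n:p_1(x)\ge0,\dots,p_m(x)\ge0\}$ for polynomials $p_1,\dots,p_m$. $\mathrm{conv}(\mathbf{K})$ denotes the convex hull of $\mathbf{K}$. (The $\sigma$ above are the feasible points of the level-$d$ problem of the measure-based upper bound hierarchy $u_d^\star=\inf\{\int f\sigma\,d\mu:\sigma\in\Sigma,\deg\sigma\le d,\int\sigma\,d\mu=1\}$ for minimizing $f$ on $\mathbf{K}$, where $\mu$ is a fixed reference measure.) *)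

theory Defs
  imports "HOL-Analysis.Analysis" "HOL-Library.Poly_Mapping"
begin

text \<open>
  The ring $\mathbb{R}[X_1,\dots,X_n]$ is the monoid algebra of exponent vectors over the reals; its
  ring structure is the one of \<^theory>\<open>HOL-Library.Poly_Mapping\<close>. The variables are indexed by the
  finite type \<open>'n\<close> that also indexes the coordinates of $\mathbb{R}^n$.
\<close>

type_synonym 'n mpoly = "('n \<Rightarrow>\<^sub>0 nat) \<Rightarrow>\<^sub>0 real"

definition mvar :: "'n \<Rightarrow> 'n mpoly" where
  "mvar i = Poly_Mapping.single (Poly_Mapping.single i 1) 1"

definition monom_val :: "('n::finite \<Rightarrow>\<^sub>0 nat) \<Rightarrow> real ^ 'n \<Rightarrow> real" where
  "monom_val \<alpha> x = (\<Prod>i\<in>UNIV. x $ i ^ Poly_Mapping.lookup \<alpha> i)"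

definition meval :: "'n::finite mpoly \<Rightarrow> real ^ 'n \<Rightarrow> real" where
  "meval p x = (\<Sum>\<alpha>\<in>Poly_Mapping.keys p. Poly_Mapping.lookup p \<alpha> * monom_val \<alpha> x)"

text \<open>The total degree, with the convention that the zero polynomial has degree 0.\<close>

definition total_degree :: "'n::finite mpoly \<Rightarrow> nat" where
  "total_degree p =
     Max (insert 0 ((\<lambda>\<alpha>. \<Sum>i\<in>UNIV. Poly_Mapping.lookup \<alpha> i) ` Poly_Mapping.keys p))"

definition sos :: "'n mpoly set" where
  "sos = {\<sigma>. \<exists>qs. \<sigma> = (\<Sum>q\<leftarrow>qs. q ^ 2)}"

definition basic_closed_semialgebraic :: "(real ^ 'n::finite) set \<Rightarrow> bool" where
  "basic_closed_semialgebraic K \<longleftrightarrow>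
     (\<exists>P :: 'n mpoly set. finite P \<and> K = {x. \<forall>p\<in>P. meval p x \<ge> 0})"

definition measure_support :: "'a::topological_space measure \<Rightarrow> 'a set" where
  "measure_support \<mu> = {x. \<forall>U. open U \<longrightarrow> x \<in> U \<longrightarrow> emeasure \<mu> U > 0}"

text \<open>The case \<open>\<alpha> = 0\<close> makes the measure itself finite.\<close>

definition finite_moments :: "(real ^ 'n::finite) measure \<Rightarrow> bool" where
  "finite_moments \<mu> \<longleftrightarrow> (\<forall>\<alpha>. integrable \<mu> (monom_val \<alpha>))"

end

theory Submission
  imports Defs "HOL-Probability.Probability_Measure"
begin

text \<open>
  The mean of a random vector that lies almost surely in a convex set \<open>C\<close> lies in \<open>C\<close>, even when \<open>C\<close>
  is not closed: otherwise a hyperplane through the mean separates it from \<open>C\<close>, the random vector lies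
  almost surely in this hyperplane, and \<open>C\<close> can be replaced by a slice of smaller dimension. Applied to
  the convex hull of \<open>K\<close> this gives the first claim; applied to the epigraph of \<open>f\<close> and the random
  vector \<open>(x, f x)\<close> it gives Jensen's inequality. Both are used for the probability measure with
  density \<open>\<sigma>\<close> with respect to \<open>\<mu>\<close>.
\<close>

lemma (in prob_space) expectation_in_convex:
  fixes X :: "'a \<Rightarrow> 'b::euclidean_space"
  assumes X: "integrable M X" and "convex C" and "AE \<omega> in M. X \<omega> \<in> C"
  shows "expectation X \<in> C"
  using assms(2,3)
\<comment> \<open>The mean is inserted because it need not lie in \<open>C\<close> while the
  induction runs. Since \<open>aff_dim\<close> is at least -1, the shift by 1 ensures that
  \<open>nat\<close> preserves strict decrease.\<close>
proof (induction "nat (aff_dim (insert (expectation X) C) + 1)" arbitrary: C rule: less_induct)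
  case less
  let ?m = "expectation X"
  show ?case
  proof (rule ccontr)
    assume notin: "?m \<notin> C"
    have "C \<noteq> {}"
      using less.prems(2) by auto
    \<comment> \<open>The normal \<open>a\<close> can be chosen parallel to the affine hull. Hence
      \<open>?m + a\<close> lies in that hull but off the hyperplane, which forces the dimension of
      the slice to drop.\<close>
    then obtain a b where a: "?m + a \<in> affine hull (insert ?m C)" "a \<noteq> 0" "a \<bullet> ?m \<le> b"
      and b: "\<And>x. x \<in> C \<Longrightarrow> a \<bullet> x \<ge> b"
      using separating_hyperplane_set_point_inaff less.prems(1) notin by metis
    have int: "integrable M (\<lambda>\<omega>. a \<bullet> X \<omega> - a \<bullet> ?m)"
      using X by simp
    have "AE \<omega> in M. 0 \<le> a \<bullet> X \<omega> - a \<bullet> ?m"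
      using less.prems(2) by eventually_elim (use a(3) b in force)
    moreover have "expectation (\<lambda>\<omega>. a \<bullet> X \<omega> - a \<bullet> ?m) = 0"
      using X by (simp add: prob_space)
    \<comment> \<open>A nonnegative integrable function with integral zero vanishes almost
      everywhere.\<close>
    ultimately have "AE \<omega> in M. a \<bullet> X \<omega> - a \<bullet> ?m = 0"
      using integral_nonneg_eq_0_iff_AE[OF int] by simp
    then have AE': "AE \<omega> in M. X \<omega> \<in> C \<inter> {x. a \<bullet> x = a \<bullet> ?m}"
      using less.prems(2) by eventually_elim simp
    let ?C' = "C \<inter> {x. a \<bullet> x = a \<bullet> ?m}"
    have conv': "convex ?C'"
      using less.prems(1) convex_hyperplane by (rule convex_Int)
    have "affine hull (insert ?m ?C') \<subseteq> {x. a \<bullet> x = a \<bullet> ?m}"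
      by (rule hull_minimal) (auto simp: affine_hyperplane)
    moreover have "a \<bullet> (?m + a) \<noteq> a \<bullet> ?m"
      using a(2) by (simp add: inner_add_right)
    ultimately have "?m + a \<notin> affine hull (insert ?m ?C')"
      by blast
    moreover have "affine hull (insert ?m ?C') \<subseteq> affine hull (insert ?m C)"
      by (rule hull_mono) auto
    ultimately have "affine hull (insert ?m ?C') \<subset> affine hull (insert ?m C)"
      using a(1) by blast
    then have "aff_dim (insert ?m ?C') < aff_dim (insert ?m C)"
      by (rule aff_dim_psubset)
    moreover have "-1 \<le> aff_dim (insert ?m ?C')"
      by (rule aff_dim_geq)
    ultimately have "nat (aff_dim (insert ?m ?C') + 1) < nat (aff_dim (insert ?m C) + 1)"
      by simp
    from less.hyps[OF this conv' AE'] notin show False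
      by simp
  qed
qed

lemma (in prob_space) convex_on_expectation_le:
  fixes X :: "'a \<Rightarrow> 'b::euclidean_space"
  assumes X: "integrable M X" and gX: "integrable M (\<lambda>\<omega>. g (X \<omega>))"
    and g: "convex_on C g" and AE: "AE \<omega> in M. X \<omega> \<in> C"
  shows "g (expectation X) \<le> expectation (\<lambda>\<omega>. g (X \<omega>))"
proof -
  \<comment> \<open>Splitting the pair into two linear embeddings shows that its mean is the pair of
    the means.\<close>
  have "has_bochner_integral M (\<lambda>\<omega>. (X \<omega>, 0) + (0, g (X \<omega>))) 
      ((expectation X, 0) + (0, expectation (\<lambda>\<omega>. g (X \<omega>))))"
    by (intro has_bochner_integral_add
        has_bochner_integral_bounded_linear[where T = "\<lambda>x. (x, 0)"]
        has_bochner_integral_bounded_linear[where T = "\<lambda>x. (0, x)"]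
        has_bochner_integral_integrable X gX bounded_linear_Pair bounded_linear_ident
        bounded_linear_zero)
  then have pair: "has_bochner_integral M (\<lambda>\<omega>. (X \<omega>, g (X \<omega>)))
      (expectation X, expectation (\<lambda>\<omega>. g (X \<omega>)))"
    by simp
  have "expectation (\<lambda>\<omega>. (X \<omega>, g (X \<omega>))) \<in> epigraph C g"
  proof (rule expectation_in_convex)
    show "integrable M (\<lambda>\<omega>. (X \<omega>, g (X \<omega>)))"
      using pair by (rule integrable.intros)
    show "convex (epigraph C g)"
      using g by (rule convex_epigraphI)
    show "AE \<omega> in M. (X \<omega>, g (X \<omega>)) \<in> epigraph C g"
      using AE by eventually_elim (simp add: mem_epigraph)
  qed
  then show ?thesis
    using has_bochner_integral_integral_eq[OF pair] by (simp add: mem_epigraph)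
qed

text \<open>The complement of the support is the union of all open null sets; by Lindelof countably
  many of them already cover it, so it is null.\<close>

lemma AE_in_measure_support:
  fixes \<mu> :: "'a::second_countable_topology measure"
  assumes sets: "sets \<mu> = sets borel"
  shows "AE x in \<mu>. x \<in> measure_support \<mu>"
proof -
  let ?\<F> = "{U. open U \<and> emeasure \<mu> U = 0}"
  obtain \<F>' where \<F>': "\<F>' \<subseteq> ?\<F>" "countable \<F>'" "\<Union>\<F>' = \<Union>?\<F>"
    using Lindelof[of ?\<F>] by blast
  have "(\<Union>U\<in>\<F>'. U) \<in> null_sets \<mu>"
  proof (rule null_sets_UN')
    fix U assume "U \<in> \<F>'"
    then show "U \<in> null_sets \<mu>"
      using \<F>'(1) sets by (auto intro!: null_setsI)
  qed (fact \<F>'(2))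
  then have null: "\<Union>?\<F> \<in> null_sets \<mu>"
    using \<F>'(3) by simp
  have "x \<in> measure_support \<mu>" if "x \<notin> \<Union>?\<F>" for x
    using that by (auto simp: measure_support_def zero_less_iff_neq_zero)
  then show ?thesis
    using AE_not_in[OF null] by (auto elim: eventually_mono)
qed

text \<open>Allows \<open>p\<close>, \<open>q\<close> and \<open>p + q\<close> to be summed over one
  index set, although cancellation may remove keys of the sum.\<close>

lemma meval_eq_sum_superset:
  assumes "finite A" "Poly_Mapping.keys p \<subseteq> A"
  shows "meval p x = (\<Sum>\<alpha>\<in>A. Poly_Mapping.lookup p \<alpha> * monom_val \<alpha> x)"
  unfolding meval_def using assms by (intro sum.mono_neutral_left) (auto simp: in_keys_iff)

lemma meval_0 [simp]: "meval 0 x = 0"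
  by (simp add: meval_def)

lemma meval_single [simp]: "meval (Poly_Mapping.single \<alpha> c) x = c * monom_val \<alpha> x"
  by (cases "c = 0") (simp_all add: meval_def)

lemma meval_add [simp]: "meval (p + q) x = meval p x + meval q x"
proof -
  let ?A = "Poly_Mapping.keys p \<union> Poly_Mapping.keys q"
  have "finite ?A" "Poly_Mapping.keys (p + q) \<subseteq> ?A"
    by (simp_all add: Poly_Mapping.keys_add)
  then show ?thesis
    by (simp add: meval_eq_sum_superset[of ?A] lookup_add distrib_right sum.distrib)
qed

text \<open>Updating at a fresh key amounts to adding a single term. Additive maps are thereby
  determined on single terms, so multiplicativity of \<open>meval\<close> reduces to monomials
  without describing the keys of a product.\<close>

lemma poly_mapping_add_single_induct [case_names zero add_single]:
  fixes p :: "'a \<Rightarrow>\<^sub>0 'b::monoid_add"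
  assumes "P 0" and "\<And>p k c. P p \<Longrightarrow> P (p + Poly_Mapping.single k c)"
  shows "P p"
proof (induction p rule: update_induct)
  case const
  show ?case by (fact assms(1))
next
  case (update p k c)
  have "Poly_Mapping.update k c p = p + Poly_Mapping.single k c"
    using update(1)
    by (intro poly_mapping_eqI) (auto simp: lookup_update lookup_add lookup_single in_keys_iff)
  then show ?case
    using assms(2)[OF update(3)] by simp
qed

lemma monom_val_add: "monom_val (\<alpha> + \<beta>) x = monom_val \<alpha> x * monom_val \<beta> x"
  by (simp add: monom_val_def lookup_add power_add prod.distrib)

lemma meval_mult [simp]: "meval (p * q) x = meval p x * meval q x"
proof (induction p rule: poly_mapping_add_single_induct)
  case zero
  show ?case by simp
next
  case (add_single p \<alpha> c)
  have "meval (Poly_Mapping.single \<alpha> c * q) x = c * monom_val \<alpha> x * meval q x"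
    by (induction q rule: poly_mapping_add_single_induct)
      (simp_all add: distrib_left mult_single monom_val_add)
  with add_single show ?case
    by (simp add: distrib_right)
qed

lemma meval_mvar [simp]: "meval (mvar i) = (\<lambda>x. x $ i)"
proof
  fix x
  have "monom_val (Poly_Mapping.single i 1) x = (\<Prod>j\<in>UNIV. if j = i then x $ j else 1)"
    unfolding monom_val_def by (intro prod.cong) (auto simp: lookup_single)
  then show "meval (mvar i) x = x $ i"
    by (simp add: mvar_def)
qed

lemma meval_sos_nonneg:
  assumes "\<sigma> \<in> sos"
  shows "meval \<sigma> x \<ge> 0"
proof -
  obtain qs where "\<sigma> = (\<Sum>q\<leftarrow>qs. q ^ 2)"
    using assms by (auto simp: sos_def)
  moreover have "meval (\<Sum>q\<leftarrow>qs. q ^ 2) x \<ge> 0"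
    by (induction qs) (simp_all add: power2_eq_square)
  ultimately show ?thesis
    by simp
qed

lemma integrable_meval:
  assumes "finite_moments \<mu>"
  shows "integrable \<mu> (meval p)"
proof -
  have "integrable \<mu> (\<lambda>x. \<Sum>\<alpha>\<in>Poly_Mapping.keys p. Poly_Mapping.lookup p \<alpha> * monom_val \<alpha> x)"
    using assms by (auto simp: finite_moments_def)
  then show ?thesis
    by (simp add: meval_def [abs_def])
qed

theorem proposition6p4:
  fixes K :: "(real ^ 'n::finite) set" and \<mu> :: "(real ^ 'n) measure"
    and f \<sigma> :: "'n mpoly" and d :: nat and xc :: "real ^ 'n"
  assumes "basic_closed_semialgebraic K"
    and "sets \<mu> = sets borel"
    and "measure_support \<mu> = K"
    and "finite_moments \<mu>"
    and "\<sigma> \<in> sos"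
    and "total_degree \<sigma> \<le> d"
    and "(LINT x|\<mu>. meval \<sigma> x) = 1"
    and "xc = (\<chi> i. LINT x|\<mu>. meval (mvar i * \<sigma>) x)"
  shows "xc \<in> convex hull K \<and>
    (convex_on (convex hull K) (meval f) \<longrightarrow> meval f xc \<le> (LINT x|\<mu>. meval (f * \<sigma>) x))"
proof -
  note sets = assms(2) and fin = assms(4)
  define P where "P = density \<mu> (meval \<sigma>)"
  have meas: "meval p \<in> borel_measurable \<mu>" for p
    using integrable_meval[OF fin] by (rule borel_measurable_integrable)
  have nonneg: "meval \<sigma> x \<ge> 0" for x
    using assms(5) by (rule meval_sos_nonneg)
  \<comment> \<open>Integrating \<open>p\<close> against the density means integrating the
    polynomial \<open>p * \<sigma>\<close> against \<open>\<mu>\<close>, and that has finite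
    moments.\<close>
  have integrable: "integrable P (meval p)" for p
    unfolding P_def
    by (subst integrable_density)
      (simp_all add: meas nonneg integrable_meval fin flip: meval_mult)
  have integral: "(LINT x|P. meval p x) = (LINT x|\<mu>. meval (p * \<sigma>) x)" for p
    unfolding P_def
    by (subst integral_density) (simp_all add: meas nonneg mult.commute flip: meval_mult)
  interpret prob_space P
  proof
    have "emeasure P (space P) = (\<integral>\<^sup>+x. meval \<sigma> x \<partial>\<mu>)"
      unfolding P_def using meas[of \<sigma>]
      by (simp add: emeasure_density cong: nn_integral_cong)
    also have "\<dots> = 1"
      using assms(7) by (subst nn_integral_eq_integral) (simp_all add: integrable_meval fin nonneg)
    finally show "emeasure P (space P) = 1" .
  qed
  \<comment> \<open>Having a density with respect to \<open>\<mu>\<close>, \<open>P\<close> inherits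
    its null sets.\<close>
  have "AE x in P. x \<in> K"
    using AE_in_measure_support[OF sets] meas[of \<sigma>] assms(3)
    unfolding P_def by (subst AE_density) (auto elim: eventually_mono)
  then have AE: "AE x in P. x \<in> convex hull K"
    by eventually_elim (rule hull_inc)
  have coord: "integrable P (\<lambda>x. x $ i)" for i
    using integrable[of "mvar i"] by simp
  \<comment> \<open>Expansion in the standard basis turns integrability of the coordinates into that
    of the identity.\<close>
  have "(\<Sum>i\<in>UNIV. x $ i *\<^sub>R axis i 1) = x" for x :: "real ^ 'n"
    using basis_expansion[of x] by (simp only: scalar_mult_eq_scaleR)
  moreover have "integrable P (\<lambda>x. \<Sum>i\<in>UNIV. x $ i *\<^sub>R axis i (1 :: real))"
    using coord by (intro Bochner_Integration.integrable_sum integrable_scaleR_left) auto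
  ultimately have X: "integrable P (\<lambda>x. x)"
    by simp
  \<comment> \<open>Coordinate projections are bounded linear and so commute with the integral; thus
    \<open>xc\<close> is the mean of \<open>P\<close>.\<close>
  have "xc $ i = expectation (\<lambda>x. x) $ i" for i
    using integral_bounded_linear[OF bounded_linear_vec_nth X, of i] integral[of "mvar i"]
    by (simp add: assms(8))
  then have "xc = expectation (\<lambda>x. x)"
    by (simp add: vec_eq_iff)
  with expectation_in_convex[OF X convex_convex_hull AE]
    convex_on_expectation_le[OF X integrable _ AE] integral
  show ?thesis
    by auto
qed

end
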